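(* Let $A_0,\dots,A_n\in\mathcal S^p$ be such that the linear copositive system $\mathcal A(\mathbf x)\in\mathcal{COP}^p$ is consistent. Then this system yields the uniform LP duality if and only if both of the following conditions hold: I) $\mathbf b(k,j)\in \mathrm{cone}\{\mathbf a(\mathbf t):\ \mathbf t\in T_{im}\}$ for all $k\in M(j)$ and all $j\in J$; II) $\mathbf b(k,j)\in \mathrm{cone}\{\mathbf a(\mathbf t):\ \mathbf t\in T_{im}(k,j)\}$ for all $k\in N(j)$ and all $j\in J$.
   Context: Fix integers $p>1$, $n\ge 1$. $\mathcal S^p$ is the space of real symmetric $p\times p$ matrices with $A\bullet B=\mathrm{trace}(AB)$; $\mathbf e_1,\dots,\mathbf e_p$ is the standard basis of $\mathbb R^p$; $\mathbb R^p_+$ is the set of vectors with non-negative components; $P=\{1,\dots,p\}$; $T=\{\mathbf t\in\mathbb R^p_+:\sum_{k\in P} t_k=1\}$. $\mathcal{COP}^p=\{D\in\mathcal S^p:\mathbf t^\top D\mathbf t\ge 0\ \forall \mathbf t\in\mathbb R^p_+\}$ and $\mathcal{CP}^p=\mathrm{conv}\{\mathbf t\mathbf t^\top:\mathbf t\in\mathbb R^p_+\}$. For a set $\mathcal B$, $\mathrm{cone}\,\mathcal B$ is the set of all finite linear combinations of elements of $\mathcal B$ with non-negative coefficients (so $\mathrm{cone}\,\emptyset=\{0\}$). Given $A_0,\dots,A_n\in\mathcal S^p$, put $\mathcal A(\mathbf x)=A_0+\sum_{m=1}^n x_mA_m$ for $\mathbf x\in\mathbb R^n$ and $X=\{\mathbf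 x\in\mathbb R^n:\mathcal A(\mathbf x)\in\mathcal{COP}^p\}$. The system $\mathcal A(\mathbf x)\in\mathcal{COP}^p$ is consistent if $X\ne\emptyset$. For $\mathbf c\in\mathbb R^n$ consider the primal problem (P): $\min \mathbf c^\top\mathbf x$ s.t. $\mathbf x\in X$, and its Lagrange dual (D): $\max\,(-U\bullet A_0)$ s.t. $U\bullet A_m=c_m$, $m=1,\dots,n$, $U\in\mathcal{CP}^p$; $Val(\cdot)$ denotes the optimal value. A consistent system yields the uniform LP duality if for every $\mathbf c\in\mathbb R^n$ with $Val(\mathrm P)>-\infty$ the dual (D) has an optimal solution and $Val(\mathrm P)=Val(\mathrm D)$. The set of normalized immobile indices is $T_{im}=\{\mathbf t\in T:\mathbf t^\top\mathcal A(\mathbf x)\mathbf t=0\ \forall\mathbf x\in X\}$; it is empty or a finite union of convex bounded polyhedra. $\{\boldsymbol\tau(j):j\in J\}$, $|J|<\infty$, is the set of vertices of $\mathrm{conv}\,T_{im}$ ($J=\emptyset$ if $T_{im}=\emptyset$, and then conditions quantified over $j\in J$ are regarded as fulfilled). For $j\in J$: $M(j)=\{k\in P:\mathbf e_k^\top\mathcal A(\mathbf x)\boldsymbol\tau(j)=0\ \forall\mathbf x\in X\}$, $N_*(j)=\{k\in P:\exists\,\mathbf x\in X \text{ with } \mathbf e_k^\top\mathcal A(\mathbf x)\boldsymbol\tau(j)=0\}$, $N(j)=N_*(j)\setminus M(j)$. For $j\in J$, $k\in N_*(j)$: $X(k,j)=\{\mathbf x\in X:\mathbf e_k^\top\mathcal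 A(\mathbf x)\boldsymbol\tau(j)=0\}$ and $T_{im}(k,j)=\{\mathbf t\in T:\mathbf t^\top\mathcal A(\mathbf x)\mathbf t=0\ \forall\mathbf x\in X(k,j)\}$. Vectors in $\mathbb R^{n+1}$: $\mathbf a(\mathbf t)=(\mathbf t^\top A_m\mathbf t)_{m=0,\dots,n}$ for $\mathbf t\in T$, and $\mathbf b(k,j)=(\mathbf e_k^\top A_m\boldsymbol\tau(j))_{m=0,\dots,n}$ for $k\in P$, $j\in J$. *)

theory Defs
  imports "HOL-Analysis.Analysis"
begin

text \<open>
  The coefficient matrices are given as the constant one \<open>A0\<close> together with a family \<open>A\<close> indexed by
  the finite type \<open>'n\<close>, so that \<open>CARD('n)\<close> is the number \<open>n\<close> of variables; a vector
  with components numbered \<open>0, \<dots>, n\<close> is a pair in \<open>real \<times> (real ^ 'n)\<close>.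
\<close>

definition sym_matrices :: "(real ^ 'p ^ 'p) set" where
  "sym_matrices = {D. transpose D = D}"

definition mat_inner :: "real ^ 'p ^ 'p \<Rightarrow> real ^ 'p ^ 'p \<Rightarrow> real" where
  "mat_inner C D = trace (C ** D)"

definition nonneg_vectors :: "(real ^ 'p) set" where
  "nonneg_vectors = {t. \<forall>k. 0 \<le> t $ k}"

definition std_simplex :: "(real ^ 'p) set" where
  "std_simplex = {t \<in> nonneg_vectors. (\<Sum>k\<in>UNIV. t $ k) = 1}"

definition copositive_cone :: "(real ^ 'p ^ 'p) set" where
  "copositive_cone = {D \<in> sym_matrices. \<forall>t\<in>nonneg_vectors. 0 \<le> t \<bullet> (D *v t)}"

definition completely_positive_cone :: "(real ^ 'p ^ 'p) set" where
  "completely_positive_cone = convex hull ((\<lambda>t. \<chi> i j. t $ i * t $ j) ` nonneg_vectors)"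

text \<open>
  The library predicate \<open>cone\<close> does not require convexity, so \<open>cone hull\<close> is not the set below.
\<close>

definition fin_cone :: "'a::real_vector set \<Rightarrow> 'a set" where
  "fin_cone B = {y. \<exists>F u. finite F \<and> F \<subseteq> B \<and> (\<forall>v\<in>F. 0 \<le> u v) \<and> y = (\<Sum>v\<in>F. u v *\<^sub>R v)}"

lemma fin_cone_eq_convex_cone_hull: "fin_cone B = convex_cone hull B"
proof
  show "fin_cone B \<subseteq> convex_cone hull B"
  proof
    fix y assume "y \<in> fin_cone B"
    then obtain F u where F: "finite F" "F \<subseteq> B" "\<forall>v\<in>F. 0 \<le> u v"
      and y: "y = (\<Sum>v\<in>F. u v *\<^sub>R v)"
      unfolding fin_cone_def by blast
    have "(\<Sum>v\<in>F. u v *\<^sub>R v) \<in> convex_cone hull B"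
      using F
    proof (induction F rule: finite_induct)
      case empty
      show ?case by (simp add: convex_cone_hull_contains_0)
    next
      case (insert v F)
      have "u v *\<^sub>R v \<in> convex_cone hull B"
        using insert.prems by (intro convex_cone_hull_mul hull_inc) auto
      moreover have "(\<Sum>v\<in>F. u v *\<^sub>R v) \<in> convex_cone hull B"
        using insert.IH insert.prems by blast
      ultimately show ?case
        using insert.hyps by (simp add: convex_cone_hull_add)
    qed
    with y show "y \<in> convex_cone hull B" by simp
  qed
next
  show "convex_cone hull B \<subseteq> fin_cone B"
  proof
    fix y assume "y \<in> convex_cone hull B"
    then consider "y = 0" | x c where "x \<in> convex hull B" "0 \<le> c" "y = c *\<^sub>R x"
      unfolding convex_cone_hull_convex_hull by auto
    then show "y \<in> fin_cone B"
    proof cases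
      case 1
      then show ?thesis
        unfolding fin_cone_def mem_Collect_eq by (intro exI[of _ "{}"]) simp
    next
      case (2 x c)
      then obtain F u where F: "finite F" "F \<subseteq> B" "\<forall>v\<in>F. 0 \<le> u v"
        and x: "(\<Sum>v\<in>F. u v *\<^sub>R v) = x"
        unfolding convex_hull_explicit by blast
      have "\<forall>v\<in>F. 0 \<le> c * u v" "y = (\<Sum>v\<in>F. (c * u v) *\<^sub>R v)"
        using F(3) 2 x by (auto simp: scaleR_sum_right)
      with F(1,2) show ?thesis
        unfolding fin_cone_def mem_Collect_eq by (intro exI[of _ F] exI[of _ "\<lambda>v. c * u v"] conjI)
    qed
  qed
qed

definition lin_mat :: "real ^ 'p ^ 'p \<Rightarrow> ('n::finite \<Rightarrow> real ^ 'p ^ 'p) \<Rightarrow> real ^ 'n \<Rightarrow> real ^ 'p ^ 'p" where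
  "lin_mat A0 A x = A0 + (\<Sum>m\<in>UNIV. x $ m *\<^sub>R A m)"

definition feasible_set :: "real ^ 'p ^ 'p \<Rightarrow> ('n::finite \<Rightarrow> real ^ 'p ^ 'p) \<Rightarrow> (real ^ 'n) set" where
  "feasible_set A0 A = {x. lin_mat A0 A x \<in> copositive_cone}"

definition consistent_system :: "real ^ 'p ^ 'p \<Rightarrow> ('n::finite \<Rightarrow> real ^ 'p ^ 'p) \<Rightarrow> bool" where
  "consistent_system A0 A \<longleftrightarrow> feasible_set A0 A \<noteq> {}"

definition primal_val ::
    "real ^ 'p ^ 'p \<Rightarrow> ('n::finite \<Rightarrow> real ^ 'p ^ 'p) \<Rightarrow> real ^ 'n \<Rightarrow> ereal" where
  "primal_val A0 A c = (INF x\<in>feasible_set A0 A. ereal (c \<bullet> x))"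

definition dual_feasible_set ::
    "('n::finite \<Rightarrow> real ^ 'p ^ 'p) \<Rightarrow> real ^ 'n \<Rightarrow> (real ^ 'p ^ 'p) set" where
  "dual_feasible_set A c =
     {U \<in> completely_positive_cone. \<forall>m. mat_inner U (A m) = c $ m}"

definition dual_val ::
    "real ^ 'p ^ 'p \<Rightarrow> ('n::finite \<Rightarrow> real ^ 'p ^ 'p) \<Rightarrow> real ^ 'n \<Rightarrow> ereal" where
  "dual_val A0 A c = (SUP U\<in>dual_feasible_set A c. ereal (- mat_inner U A0))"

definition dual_optimal ::
    "real ^ 'p ^ 'p \<Rightarrow> ('n::finite \<Rightarrow> real ^ 'p ^ 'p) \<Rightarrow> real ^ 'n \<Rightarrow> real ^ 'p ^ 'p \<Rightarrow> bool" where
  "dual_optimal A0 A c U \<longleftrightarrow>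
     U \<in> dual_feasible_set A c \<and>
     (\<forall>V\<in>dual_feasible_set A c. - mat_inner V A0 \<le> - mat_inner U A0)"

definition uniform_LP_duality :: "real ^ 'p ^ 'p \<Rightarrow> ('n::finite \<Rightarrow> real ^ 'p ^ 'p) \<Rightarrow> bool" where
  "uniform_LP_duality A0 A \<longleftrightarrow>
     (\<forall>c. primal_val A0 A c > - \<infinity> \<longrightarrow>
        (\<exists>U. dual_optimal A0 A c U) \<and> primal_val A0 A c = dual_val A0 A c)"

definition null_indices ::
    "real ^ 'p ^ 'p \<Rightarrow> ('n::finite \<Rightarrow> real ^ 'p ^ 'p) \<Rightarrow> (real ^ 'n) set \<Rightarrow> (real ^ 'p) set" where
  "null_indices A0 A Y = {t \<in> std_simplex. \<forall>x\<in>Y. t \<bullet> (lin_mat A0 A x *v t) = 0}"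

definition immobile_indices ::
    "real ^ 'p ^ 'p \<Rightarrow> ('n::finite \<Rightarrow> real ^ 'p ^ 'p) \<Rightarrow> (real ^ 'p) set" where
  "immobile_indices A0 A = null_indices A0 A (feasible_set A0 A)"

text \<open>
  The convex hull of the immobile indices is a polytope, whose vertices are its extreme points. The
  vertices \<open>\<tau>\<close> themselves serve as indices \<open>j\<close> in the definitions that follow.
\<close>

definition immobile_vertices ::
    "real ^ 'p ^ 'p \<Rightarrow> ('n::finite \<Rightarrow> real ^ 'p ^ 'p) \<Rightarrow> (real ^ 'p) set" where
  "immobile_vertices A0 A = {\<tau>. \<tau> extreme_point_of (convex hull (immobile_indices A0 A))}"

definition M_set ::
    "real ^ 'p ^ 'p \<Rightarrow> ('n::finite \<Rightarrow> real ^ 'p ^ 'p) \<Rightarrow> real ^ 'p \<Rightarrow> 'p set" where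
  "M_set A0 A \<tau> = {k. \<forall>x\<in>feasible_set A0 A. axis k 1 \<bullet> (lin_mat A0 A x *v \<tau>) = 0}"

definition N_star_set ::
    "real ^ 'p ^ 'p \<Rightarrow> ('n::finite \<Rightarrow> real ^ 'p ^ 'p) \<Rightarrow> real ^ 'p \<Rightarrow> 'p set" where
  "N_star_set A0 A \<tau> = {k. \<exists>x\<in>feasible_set A0 A. axis k 1 \<bullet> (lin_mat A0 A x *v \<tau>) = 0}"

definition N_set ::
    "real ^ 'p ^ 'p \<Rightarrow> ('n::finite \<Rightarrow> real ^ 'p ^ 'p) \<Rightarrow> real ^ 'p \<Rightarrow> 'p set" where
  "N_set A0 A \<tau> = N_star_set A0 A \<tau> - M_set A0 A \<tau>"

definition feasible_face ::
    "real ^ 'p ^ 'p \<Rightarrow> ('n::finite \<Rightarrow> real ^ 'p ^ 'p) \<Rightarrow> 'p \<Rightarrow> real ^ 'p \<Rightarrow> (real ^ 'n) set" where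
  "feasible_face A0 A k \<tau> =
     {x \<in> feasible_set A0 A. axis k 1 \<bullet> (lin_mat A0 A x *v \<tau>) = 0}"

definition immobile_indices_face ::
    "real ^ 'p ^ 'p \<Rightarrow> ('n::finite \<Rightarrow> real ^ 'p ^ 'p) \<Rightarrow> 'p \<Rightarrow> real ^ 'p \<Rightarrow> (real ^ 'p) set" where
  "immobile_indices_face A0 A k \<tau> = null_indices A0 A (feasible_face A0 A k \<tau>)"

definition a_vec ::
    "real ^ 'p ^ 'p \<Rightarrow> ('n::finite \<Rightarrow> real ^ 'p ^ 'p) \<Rightarrow> real ^ 'p \<Rightarrow> real \<times> (real ^ 'n)" where
  "a_vec A0 A t = (t \<bullet> (A0 *v t), \<chi> m. t \<bullet> (A m *v t))"

definition b_vec ::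
    "real ^ 'p ^ 'p \<Rightarrow> ('n::finite \<Rightarrow> real ^ 'p ^ 'p) \<Rightarrow> 'p \<Rightarrow> real ^ 'p \<Rightarrow> real \<times> (real ^ 'n)" where
  "b_vec A0 A k \<tau> = (axis k 1 \<bullet> (A0 *v \<tau>), \<chi> m. axis k 1 \<bullet> (A m *v \<tau>))"

end

theory Submission
  imports Defs
begin

text \<open>
  Pairing \<open>(1, x)\<close> with \<open>a(t)\<close> gives \<open>t\<^sup>T \<A>(x) t\<close>, so feasibility of \<open>x\<close> is the semi-infinite linear
  system \<open>(1, x) \<bullet> a(t) \<ge> 0\<close> over the simplex, and \<open>U \<mapsto> (U \<bullet> A\<^sub>0, \<dots>, U \<bullet> A\<^sub>n)\<close> maps the completely
  positive matrices onto the cone \<open>K\<close> generated by all \<open>a(t)\<close>. Let the polar of the feasible set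
  \<open>X\<close> consist of the \<open>q = (d, c)\<close> with \<open>d + c \<bullet> x \<ge> 0\<close> on \<open>X\<close>. Uniform duality then says that every
  such \<open>q\<close> lies in \<open>K\<close> plus the ray of \<open>(1, 0)\<close>; if moreover \<open>q\<close> vanishes somewhere on \<open>X\<close>,
  then \<open>- d\<close> is the optimal value for \<open>c\<close> and \<open>q\<close> lies in \<open>K\<close> itself.

  Necessity. For a vertex \<open>\<tau>\<close> the matrix \<open>\<A>(x)\<close> is copositive and \<open>\<tau>\<^sup>T \<A>(x) \<tau> = 0\<close>, whence
  \<open>\<A>(x) \<tau> \<ge> 0\<close>. So \<open>b(k, \<tau>)\<close> is in the polar, and if some feasible point annihilates it, it lies
  in \<open>K\<close> (\<open>uniform_LP_duality_active\<close>). On the face where \<open>b(k, \<tau>)\<close> vanishes, every \<open>a(t)\<close> that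
  occurs in such a representation with positive weight must vanish as well (\<open>fin_cone_face\<close>).

  Sufficiency. Both conditions together say that \<open>b(k, \<tau>) \<in> K\<close> whenever the constraint
  \<open>(1, x) \<bullet> b(k, \<tau>) \<ge> 0\<close> is active at some feasible \<open>x\<close>. The obstacle to duality is the lack of a
  Slater point at immobile indices. It is removed by replacing the constraints near these indices
  by finitely many linear ones (\<open>copositive_by_support_reduction\<close>): \<open>\<A>(x)\<close> is copositive as soon as
  \<open>\<A>(x) \<tau> \<ge> 0\<close> for one vertex \<open>\<tau>\<close> per support and \<open>w\<^sup>T \<A>(x) w \<ge> 0\<close> on the compact set \<open>\<Omega>\<close> of those
  \<open>w\<close> in the simplex whose support contains no support of a vertex. An immobile index is a convex
  combination of vertices, so \<open>\<Omega>\<close> contains none, and compactness gives a feasible point at which all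
  constraints on \<open>\<Omega>\<close> are strict. Constraints \<open>b(k, \<tau>)\<close> that are never active on \<open>X\<close> can be dropped,
  because \<open>X\<close> would otherwise be a proper clopen part of a convex set
  (\<open>inactive_constraints_redundant\<close>). For a system with finitely many linear constraints and a
  compact family that has a Slater point, the cone of consequences is closed, so the polar is
  generated by \<open>(1, 0)\<close>, the active \<open>b(k, \<tau>)\<close> and the \<open>a(w)\<close> with \<open>w \<in> \<Omega>\<close>
  (\<open>semi_infinite_Farkas\<close>); all of these lie in \<open>K\<close> plus the ray of \<open>(1, 0)\<close>.
\<close>

section \<open>Closed cones and a Farkas lemma\<close>

text \<open>
  In a convergent sequence of sums, \<open>h\<close> bounds the part that comes from \<open>W\<close>, since it is
  nonnegative on the part that comes from \<open>F\<close>. Hence the whole sequence lies in the closed set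
  formed by the polyhedral cone of \<open>F\<close> and a compact piece of the cone of \<open>W\<close>.
\<close>

lemma closed_convex_cone_hull_Un_compact:
  fixes F W :: "'a::euclidean_space set"
  assumes F: "finite F" and W: "compact W"
    and hF: "\<And>v. v \<in> F \<Longrightarrow> 0 \<le> h \<bullet> v" and hW: "\<And>w. w \<in> W \<Longrightarrow> 0 < h \<bullet> w"
  shows "closed (convex_cone hull (F \<union> W))"
proof (cases "W = {}")
  case True
  then show ?thesis using F by (simp add: closed_convex_cone_hull)
next
  case False
  define V where "V = convex hull W"
  have V: "compact V" "V \<noteq> {}"
    using W False by (auto simp: V_def compact_convex_hull)
  have hV: "0 < h \<bullet> v" if "v \<in> V" for v
  proof -
    have "V \<subseteq> {v. 0 < h \<bullet> v}"
      unfolding V_def by (rule hull_minimal) (use hW in \<open>auto simp: convex_halfspace_gt\<close>)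
    with that show ?thesis by auto
  qed
  obtain v0 where v0: "v0 \<in> V" "\<And>v. v \<in> V \<Longrightarrow> h \<bullet> v0 \<le> h \<bullet> v"
    using continuous_attains_inf[OF V, of "\<lambda>v. h \<bullet> v"]
    by (auto simp: continuous_on_inner continuous_on_const continuous_on_id)
  define \<delta> where "\<delta> = h \<bullet> v0"
  have \<delta>: "0 < \<delta>" "\<And>v. v \<in> V \<Longrightarrow> \<delta> \<le> h \<bullet> v"
    using v0 hV by (auto simp: \<delta>_def)
  have hCF: "0 \<le> h \<bullet> y" if "y \<in> convex_cone hull F" for y
  proof -
    have "convex_cone hull F \<subseteq> {y. 0 \<le> h \<bullet> y}"
      by (rule hull_minimal) (use hF in \<open>auto simp: convex_cone_halfspace_ge\<close>)
    with that show ?thesis by auto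
  qed
  have W_cone: "convex_cone hull W = {s *\<^sub>R v | s v. 0 \<le> s \<and> v \<in> V}"
    using False by (auto simp: convex_cone_hull_convex_hull_nonempty V_def)
  show ?thesis
    unfolding closed_sequential_limits
  proof (intro allI impI, elim conjE)
    fix z l assume z: "\<forall>n. z n \<in> convex_cone hull (F \<union> W)" and lim: "z \<longlonglongrightarrow> l"
    have "bounded (range z)"
      using lim convergent_imp_bounded by blast
    then obtain L where L: "\<And>n. norm (z n) \<le> L"
      unfolding bounded_iff by auto
    define M where "M = norm h * L / \<delta>"
    define Q where "Q = (\<lambda>(s, v). s *\<^sub>R v) ` ({0..M} \<times> V)"
    have "compact Q"
      unfolding Q_def case_prod_beta
      by (intro compact_continuous_image continuous_intros compact_Times V) auto
    define R where "R = (\<Union>x\<in>convex_cone hull F. \<Union>y\<in>Q. {x + y})"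
    have "closed R"
      unfolding R_def using F \<open>compact Q\<close> by (intro closed_compact_sums closed_convex_cone_hull)
    moreover have "z n \<in> R" for n
    proof -
      obtain x s v where xsv: "x \<in> convex_cone hull F" "0 \<le> s" "v \<in> V" "z n = x + s *\<^sub>R v"
        using z[rule_format, of n] by (auto simp: convex_cone_hull_Un W_cone)
      have "s * \<delta> \<le> s * (h \<bullet> v)"
        using xsv \<delta> by (intro mult_left_mono) auto
      also have "\<dots> \<le> h \<bullet> z n"
        using hCF[OF xsv(1)] by (simp add: xsv(4) inner_add_right)
      also have "\<dots> \<le> norm h * norm (z n)"
        by (rule norm_cauchy_schwarz)
      also have "\<dots> \<le> norm h * L"
        using L by (intro mult_left_mono) auto
      finally have "s \<le> M"
        using \<delta>(1) by (simp add: M_def pos_le_divide_eq)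
      then have "s *\<^sub>R v \<in> Q"
        unfolding Q_def using xsv by (intro image_eqI[of _ _ "(s, v)"]) auto
      then show ?thesis
        unfolding R_def using xsv by blast
    qed
    ultimately have "l \<in> R"
      using lim closed_sequentially by blast
    moreover have "Q \<subseteq> convex_cone hull W"
      unfolding Q_def W_cone by force
    ultimately show "l \<in> convex_cone hull (F \<union> W)"
      unfolding R_def convex_cone_hull_Un by blast
  qed
qed

text \<open>
  The point \<open>xbar\<close> is strict on the infinite family \<open>W\<close>. This makes the cone of consequences
  closed, so that a \<open>q\<close> outside could be separated from it by a vector \<open>(a\<^sub>0, y)\<close>. If \<open>a\<^sub>0 > 0\<close>,
  scaling turns it into a solution \<open>(1, x)\<close> that violates \<open>q\<close>; if \<open>a\<^sub>0 = 0\<close>, then \<open>y\<close> is a direction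
  of recession along which \<open>q\<close> decreases without bound.
\<close>

lemma semi_infinite_Farkas:
  fixes F W :: "(real \<times> 'b::euclidean_space) set"
  assumes F: "finite F" and W: "compact W"
    and xbar_F: "\<And>v. v \<in> F \<Longrightarrow> 0 \<le> (1, xbar) \<bullet> v"
    and xbar_W: "\<And>w. w \<in> W \<Longrightarrow> 0 < (1, xbar) \<bullet> w"
    and q: "\<And>x. (\<And>v. v \<in> F \<union> W \<Longrightarrow> 0 \<le> (1, x) \<bullet> v) \<Longrightarrow> 0 \<le> (1, x) \<bullet> q"
  shows "q \<in> convex_cone hull (insert (1, 0) (F \<union> W))"
proof (rule ccontr)
  define C where "C = convex_cone hull (insert (1, 0) F \<union> W)"
  assume "q \<notin> convex_cone hull (insert (1, 0) (F \<union> W))"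
  then have qC: "q \<notin> C" by (simp add: C_def)
  have C_ineqs: "0 \<le> a \<bullet> v" if "\<And>y. y \<in> C \<Longrightarrow> 0 \<le> a \<bullet> y" "v \<in> insert (1, 0) (F \<union> W)" for a v
    using that(1)[of v] that(2) hull_inc[of v "insert (1, 0) F \<union> W"] by (auto simp: C_def)
  have "closed C"
    unfolding C_def using F W xbar_F xbar_W
    by (intro closed_convex_cone_hull_Un_compact[where h = "(1, xbar)"]) auto
  then obtain a b where ab: "a \<bullet> q < b" "\<And>y. y \<in> C \<Longrightarrow> b < a \<bullet> y"
    using separating_hyperplane_closed_point[of C q] qC by (auto simp: C_def convex_convex_cone_hull)
  have "0 \<in> C" by (simp add: C_def convex_cone_hull_contains_0)
  then have "b < 0" using ab(2) by fastforce
  have aC: "0 \<le> a \<bullet> y" if "y \<in> C" for y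
  proof (rule ccontr)
    assume "\<not> 0 \<le> a \<bullet> y"
    then have neg: "a \<bullet> y < 0" by simp
    then have "(b / (a \<bullet> y)) *\<^sub>R y \<in> C"
      using that \<open>b < 0\<close> unfolding C_def by (intro convex_cone_hull_mul) (auto simp: divide_nonpos_neg)
    from ab(2)[OF this] neg show False by simp
  qed
  obtain a0 y where a: "a = (a0, y)" by (cases a)
  have aq: "a \<bullet> q < 0" using ab(1) \<open>b < 0\<close> by simp
  have "0 \<le> a0" using C_ineqs[of a "(1, 0)"] aC by (auto simp: a)
  have aFW: "0 \<le> a \<bullet> v" if "v \<in> F \<union> W" for v
    using C_ineqs[of a v] aC that by auto
  show False
  proof (cases "a0 = 0")
    case False
    with \<open>0 \<le> a0\<close> have "0 < a0" by simp
    have scale: "(1, y /\<^sub>R a0) \<bullet> v = (a \<bullet> v) / a0" for v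
      using \<open>0 < a0\<close> by (cases v) (simp add: a field_simps)
    have "0 \<le> (1, y /\<^sub>R a0) \<bullet> q"
      by (rule q) (use aFW \<open>0 < a0\<close> in \<open>simp add: scale\<close>)
    with aq \<open>0 < a0\<close> show False by (simp add: scale divide_nonneg_pos zero_le_divide_iff)
  next
    case True
    have move: "(1, xbar + s *\<^sub>R y) \<bullet> v = (1, xbar) \<bullet> v + s * (a \<bullet> v)" for s v
      by (cases v) (simp add: a True inner_add_left)
    (* far enough along y for q to drop below zero from its value at xbar *)
    define s where "s = (\<bar>(1, xbar) \<bullet> q\<bar> + 1) / - (a \<bullet> q)"
    have "0 \<le> s" unfolding s_def using aq by (intro divide_nonneg_pos) auto
    have "0 \<le> (1, xbar + s *\<^sub>R y) \<bullet> q"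
    proof (rule q)
      fix v assume v: "v \<in> F \<union> W"
      then have "0 \<le> (1, xbar) \<bullet> v"
        using xbar_F xbar_W less_imp_le by blast
      with aFW[OF v] \<open>0 \<le> s\<close> show "0 \<le> (1, xbar + s *\<^sub>R y) \<bullet> v"
        by (simp add: move)
    qed
    moreover have "s * (a \<bullet> q) = - (\<bar>(1, xbar) \<bullet> q\<bar> + 1)"
      using aq by (simp add: s_def)
    ultimately show False by (simp add: move)
  qed
qed

text \<open>
  Finitely many \<open>h\<close> suffice to be strict on all of \<open>W\<close>, and their average is strict wherever one
  of them is, as the others are nonnegative there.
\<close>

lemma exists_common_strict_point:
  fixes H W :: "'a::euclidean_space set"
  assumes H: "convex H" "H \<noteq> {}" and W: "compact W"
    and nonneg: "\<And>h w. h \<in> H \<Longrightarrow> w \<in> W \<Longrightarrow> 0 \<le> h \<bullet> w"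
    and pos: "\<And>w. w \<in> W \<Longrightarrow> \<exists>h\<in>H. 0 < h \<bullet> w"
  shows "\<exists>h\<in>H. \<forall>w\<in>W. 0 < h \<bullet> w"
proof -
  have "W \<subseteq> (\<Union>h\<in>H. {w. 0 < h \<bullet> w})" using pos by blast
  then obtain D where D: "D \<subseteq> H" "finite D" "W \<subseteq> (\<Union>h\<in>D. {w. 0 < h \<bullet> w})"
    using compactE_image[OF W, of H "\<lambda>h. {w. 0 < h \<bullet> w}"] open_halfspace_gt by metis
  show ?thesis
  proof (cases "D = {}")
    case True
    with D H show ?thesis by auto
  next
    case False
    define m where "m = (\<Sum>h\<in>D. (1 / card D) *\<^sub>R h)"
    have card: "0 < card D" using False D(2) by (simp add: card_gt_0_iff)
    have "m \<in> H"
      unfolding m_def using D H card by (intro convex_sum) auto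
    moreover have "0 < m \<bullet> w" if w: "w \<in> W" for w
    proof -
      obtain h where h: "h \<in> D" "0 < h \<bullet> w" using D w by blast
      have "0 < (\<Sum>h\<in>D. h \<bullet> w)"
        using D nonneg w h by (intro sum_pos2[of D h]) auto
      then show ?thesis
        using card by (simp add: m_def inner_sum_left flip: sum_divide_distrib)
    qed
    ultimately show ?thesis by blast
  qed
qed

text \<open>
  A constraint that never holds with equality may be written with \<open>\<ge>\<close> or with \<open>>\<close>; the solution
  set is therefore both closed and open in the connected set \<open>S\<close>.
\<close>

lemma inactive_constraints_redundant:
  fixes S :: "'b::real_normed_vector set" and f :: "'i \<Rightarrow> 'b \<Rightarrow> real"
  assumes S: "convex S" and I: "finite I" and f: "\<And>i. i \<in> I \<Longrightarrow> continuous_on UNIV (f i)"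
    and ne: "{z \<in> S. \<forall>i\<in>I. 0 \<le> f i z} \<noteq> {}"
    and inactive: "\<And>z i. z \<in> S \<Longrightarrow> \<forall>i\<in>I. 0 \<le> f i z \<Longrightarrow> i \<in> I \<Longrightarrow> f i z \<noteq> 0"
  shows "{z \<in> S. \<forall>i\<in>I. 0 \<le> f i z} = S"
proof -
  let ?T = "{z \<in> S. \<forall>i\<in>I. 0 \<le> f i z}"
  have T_closed: "?T = S \<inter> (\<Inter>i\<in>I. {z. 0 \<le> f i z})" by auto
  have T_open: "?T = S \<inter> (\<Inter>i\<in>I. {z. 0 < f i z})"
    using inactive by (force simp: order_less_le)
  have "closedin (top_of_set S) ?T"
    unfolding T_closed using f
    by (intro closedin_closed_Int closed_INT ballI closed_Collect_le continuous_on_const) auto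
  moreover have "openin (top_of_set S) ?T"
    unfolding T_open using f I
    by (intro openin_open_Int open_INT ballI open_Collect_less continuous_on_const) auto
  ultimately show ?thesis
    using convex_connected[OF S, unfolded connected_clopen, rule_format, of ?T] ne by blast
qed

section \<open>Copositive matrices and supports\<close>

lemma sym_matrices_inner_commute:
  fixes D :: "real ^ 'p ^ 'p"
  assumes "D \<in> sym_matrices"
  shows "u \<bullet> (D *v t) = t \<bullet> (D *v u)"
proof -
  have "u \<bullet> (D *v t) = (transpose D *v u) \<bullet> t"
    by (simp add: dot_lmul_matrix)
  also have "\<dots> = t \<bullet> (D *v u)"
    using assms by (simp add: sym_matrices_def inner_commute del: transpose_matrix_vector)
  finally show ?thesis .
qed

lemma sym_matrices_quadratic_add:
  fixes D :: "real ^ 'p ^ 'p"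
  assumes "D \<in> sym_matrices"
  shows "(u + s *\<^sub>R t) \<bullet> (D *v (u + s *\<^sub>R t)) =
    u \<bullet> (D *v u) + 2 * s * (u \<bullet> (D *v t)) + s\<^sup>2 * (t \<bullet> (D *v t))"
  using sym_matrices_inner_commute[OF assms, of t u]
  by (simp add: matrix_vector_right_distrib matrix_vector_mult_scaleR inner_add_left inner_add_right
      power2_eq_square algebra_simps)

lemma inner_nonneg_vector_nonneg:
  fixes u v :: "real ^ 'p"
  assumes "u \<in> nonneg_vectors" "\<And>k. 0 \<le> axis k 1 \<bullet> v"
  shows "0 \<le> u \<bullet> v"
proof -
  have "0 \<le> v $ k" for k using assms(2)[of k] by (simp add: inner_axis')
  with assms(1) show ?thesis
    by (auto simp: inner_vec_def nonneg_vectors_def intro!: sum_nonneg)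
qed

text \<open>
  A zero \<open>t\<close> of the quadratic form minimizes it over the orthant, and \<open>D t\<close> is half its gradient
  there, so no derivative in a coordinate direction can be negative.
\<close>

lemma copositive_gradient_nonneg:
  fixes D :: "real ^ 'p ^ 'p"
  assumes D: "D \<in> copositive_cone" and t: "t \<in> nonneg_vectors" "t \<bullet> (D *v t) = 0"
  shows "0 \<le> axis k 1 \<bullet> (D *v t)"
proof (rule ccontr)
  define g d where "g = axis k 1 \<bullet> (D *v t)" and "d = axis k 1 \<bullet> (D *v axis k 1)"
  assume "\<not> 0 \<le> axis k 1 \<bullet> (D *v t)"
  then have "g < 0" by (simp add: g_def)
  (* a step so short that the quadratic term cannot outweigh the linear one *)
  define s where "s = - g / (\<bar>d\<bar> + 1)"
  have "0 < s" using \<open>g < 0\<close> unfolding s_def by (intro divide_pos_pos) auto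
  have sym: "D \<in> sym_matrices" using D by (simp add: copositive_cone_def)
  have "t + s *\<^sub>R axis k 1 \<in> nonneg_vectors"
    using t \<open>0 < s\<close> by (simp add: nonneg_vectors_def axis_def)
  then have "0 \<le> 2 * s * g + s\<^sup>2 * d"
    using D sym_matrices_quadratic_add[OF sym, of t s "axis k 1"] t(2)
      sym_matrices_inner_commute[OF sym, of t "axis k 1"]
    by (auto simp: copositive_cone_def g_def d_def)
  also have "\<dots> = s * (2 * g + s * d)" by (simp add: power2_eq_square algebra_simps)
  finally have "0 \<le> 2 * g + s * d" using \<open>0 < s\<close> by (simp add: zero_le_mult_iff)
  also have "s * d \<le> s * (\<bar>d\<bar> + 1)" using \<open>0 < s\<close> by (intro mult_left_mono) auto
  also have "s * (\<bar>d\<bar> + 1) = - g" by (simp add: s_def)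
  finally show False using \<open>g < 0\<close> by simp
qed

definition support :: "real ^ 'p \<Rightarrow> 'p set" where
  "support t = {k. t $ k \<noteq> 0}"

definition avoiding_indices :: "(real ^ 'p) set \<Rightarrow> (real ^ 'p) set" where
  "avoiding_indices V = {w \<in> std_simplex. \<forall>\<tau>\<in>V. \<not> support \<tau> \<subseteq> support w}"

lemma std_simplex_nonneg: "t \<in> std_simplex \<Longrightarrow> t \<in> nonneg_vectors"
  by (simp add: std_simplex_def)

lemma support_std_simplex_nonempty: "t \<in> std_simplex \<Longrightarrow> support t \<noteq> {}"
  unfolding std_simplex_def support_def by force

lemma nonneg_vector_normalize:
  fixes t :: "real ^ 'p"
  assumes t: "t \<in> nonneg_vectors" "t \<noteq> 0"
  obtains r w where "0 < r" "w \<in> std_simplex" "t = r *\<^sub>R w" "support w = support t"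
proof
  define r where "r = (\<Sum>k\<in>UNIV. t $ k)"
  have nn: "0 \<le> t $ k" for k using t(1) by (simp add: nonneg_vectors_def)
  obtain k where "t $ k \<noteq> 0" using t(2) by (auto simp: vec_eq_iff)
  with nn[of k] have "0 < t $ k" by simp
  then show "0 < r"
    unfolding r_def using nn by (intro sum_pos2[of UNIV k]) auto
  show "t /\<^sub>R r \<in> std_simplex"
    using nn \<open>0 < r\<close>
    by (auto simp: std_simplex_def nonneg_vectors_def simp flip: sum_distrib_left) (simp add: r_def)
  show "t = r *\<^sub>R (t /\<^sub>R r)" using \<open>0 < r\<close> by simp
  show "support (t /\<^sub>R r) = support t" using \<open>0 < r\<close> by (simp add: support_def)
qed

lemma compact_std_simplex: "compact (std_simplex :: (real ^ 'p) set)"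
proof -
  have eq: "std_simplex =
      (\<Inter>k. {t :: real ^ 'p. 0 \<le> t $ k}) \<inter> {t. (\<Sum>k\<in>UNIV. t $ k) = 1}"
    by (auto simp: std_simplex_def nonneg_vectors_def)
  have "closed (std_simplex :: (real ^ 'p) set)"
    unfolding eq
    by (intro closed_Int closed_INT ballI closed_Collect_le closed_Collect_eq continuous_intros)
  moreover have "norm t \<le> 1" if "t \<in> std_simplex" for t :: "real ^ 'p"
    using that norm_le_l1_cart[of t] by (simp add: std_simplex_def nonneg_vectors_def)
  then have "bounded (std_simplex :: (real ^ 'p) set)"
    by (auto simp: bounded_iff)
  ultimately show ?thesis by (simp add: compact_eq_bounded_closed)
qed

text \<open>
  Avoiding \<open>\<tau>\<close> means that some coordinate in the support of \<open>\<tau>\<close> vanishes. This is a finite union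
  of closed conditions, so compactness is obtained without cutting out a neighbourhood of \<open>V\<close> of
  some chosen radius.
\<close>

lemma compact_avoiding_indices: "compact (avoiding_indices (V :: (real ^ 'p) set))"
proof -
  have eq: "avoiding_indices V =
      std_simplex \<inter> (\<Inter>\<tau>\<in>V. \<Union>k\<in>support \<tau>. {w. w $ k = 0})"
    by (auto simp: avoiding_indices_def support_def subset_iff)
  show ?thesis
    unfolding eq
    by (intro compact_Int_closed compact_std_simplex closed_INT ballI closed_UN finite
        closed_Collect_eq continuous_intros)
qed

text \<open>
  If the support of \<open>t\<close> contains that of some \<open>\<tau> \<in> V\<close>, subtract the largest multiple of \<open>\<tau>\<close> that
  leaves a nonnegative vector \<open>w\<close>. This kills a coordinate, and in the expansion of the form at
  \<open>t = w + \<alpha> \<tau>\<close> the mixed term and the term of \<open>\<tau>\<close> are nonnegative because \<open>D \<tau> \<ge> 0\<close>. Iterating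
  leads to a vector whose support contains no support of \<open>V\<close>.
\<close>

lemma copositive_by_support_reduction:
  fixes D :: "real ^ 'p ^ 'p"
  assumes sym: "D \<in> sym_matrices" and V: "V \<subseteq> std_simplex"
    and grad: "\<And>\<tau> k. \<tau> \<in> V \<Longrightarrow> 0 \<le> axis k 1 \<bullet> (D *v \<tau>)"
    and avoid: "\<And>w. w \<in> avoiding_indices V \<Longrightarrow> 0 \<le> w \<bullet> (D *v w)"
  shows "D \<in> copositive_cone"
proof -
  have "0 \<le> t \<bullet> (D *v t)" if "t \<in> nonneg_vectors" for t
    using that
  proof (induction "card (support t)" arbitrary: t rule: less_induct)
    case less
    consider "t = 0" | "t \<noteq> 0" "\<forall>\<tau>\<in>V. \<not> support \<tau> \<subseteq> support t"
      | \<tau> where "\<tau> \<in> V" "support \<tau> \<subseteq> support t" by blast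
    then show ?case
    proof cases
      case 1
      then show ?thesis by simp
    next
      case 2
      obtain r w where rw: "0 < r" "w \<in> std_simplex" "t = r *\<^sub>R w" "support w = support t"
        using nonneg_vector_normalize less.prems 2(1) by blast
      with 2 have "w \<in> avoiding_indices V" by (simp add: avoiding_indices_def)
      with avoid rw show ?thesis by (simp add: matrix_vector_mult_scaleR)
    next
      case (3 \<tau>)
      have \<tau>: "0 \<le> \<tau> $ k" for k
        using 3 V by (auto simp: std_simplex_def nonneg_vectors_def)
      have t: "0 \<le> t $ k" for k
        using less.prems by (simp add: nonneg_vectors_def)
      define \<alpha> where "\<alpha> = Min ((\<lambda>k. t $ k / \<tau> $ k) ` support \<tau>)"
      have ne: "support \<tau> \<noteq> {}" using 3 V support_std_simplex_nonempty by blast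
      have \<alpha>_le: "\<alpha> \<le> t $ k / \<tau> $ k" if "k \<in> support \<tau>" for k
        unfolding \<alpha>_def using that by (intro Min_le) auto
      have "\<alpha> \<in> (\<lambda>k. t $ k / \<tau> $ k) ` support \<tau>"
        unfolding \<alpha>_def using ne by (intro Min_in) auto
      then obtain i where i: "i \<in> support \<tau>" "\<alpha> = t $ i / \<tau> $ i" by blast
      have "0 \<le> \<alpha>" using i t \<tau> by simp
      define w where "w = t - \<alpha> *\<^sub>R \<tau>"
      have "0 \<le> w $ k" for k
      proof (cases "k \<in> support \<tau>")
        case True
        then have "0 < \<tau> $ k" using \<tau>[of k] by (simp add: support_def)
        with \<alpha>_le[OF True] show ?thesis by (simp add: w_def pos_le_divide_eq)
      next
        case False
        with t show ?thesis by (simp add: w_def support_def)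
      qed
      then have w: "w \<in> nonneg_vectors" by (simp add: nonneg_vectors_def)
      have "support w \<subseteq> support t"
        using 3(2) by (auto simp: support_def w_def)
      moreover have "i \<in> support t" "i \<notin> support w"
        using i 3(2) by (auto simp: support_def w_def)
      ultimately have "card (support w) < card (support t)"
        by (intro psubset_card_mono) auto
      with less.hyps w have "0 \<le> w \<bullet> (D *v w)" by blast
      moreover have "0 \<le> w \<bullet> (D *v \<tau>)" "0 \<le> \<tau> \<bullet> (D *v \<tau>)"
        using inner_nonneg_vector_nonneg[OF _ grad[OF 3(1)]] w V 3(1) std_simplex_nonneg by blast+
      moreover have "t = w + \<alpha> *\<^sub>R \<tau>" by (simp add: w_def)
      ultimately show ?thesis
        using sym_matrices_quadratic_add[OF sym, of w \<alpha> \<tau>] \<open>0 \<le> \<alpha>\<close> by simp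
    qed
  qed
  with sym show ?thesis by (simp add: copositive_cone_def)
qed

section \<open>The linear system\<close>

lemma inner_lin_mat:
  "u \<bullet> (lin_mat A0 A x *v t) = (1, x) \<bullet> (u \<bullet> (A0 *v t), \<chi> m. u \<bullet> (A m *v t))"
proof -
  have "(\<Sum>m\<in>I. x $ m *\<^sub>R A m) *v t = (\<Sum>m\<in>I. x $ m *\<^sub>R (A m *v t))" for I
    by (induction I rule: infinite_finite_induct)
      (simp_all add: matrix_vector_mult_add_rdistrib scaleR_matrix_vector_assoc)
  then show ?thesis
    by (simp add: lin_mat_def matrix_vector_mult_add_rdistrib inner_add_right inner_sum_right
        inner_vec_def[of x])
qed

lemma quadratic_lin_mat: "t \<bullet> (lin_mat A0 A x *v t) = (1, x) \<bullet> a_vec A0 A t"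
  by (simp add: inner_lin_mat a_vec_def)

lemma gradient_lin_mat: "axis k 1 \<bullet> (lin_mat A0 A x *v \<tau>) = (1, x) \<bullet> b_vec A0 A k \<tau>"
  by (simp add: inner_lin_mat b_vec_def)

lemma lin_mat_symmetric:
  assumes "A0 \<in> sym_matrices" "\<And>m. A m \<in> sym_matrices"
  shows "lin_mat A0 A x \<in> sym_matrices"
  using assms by (simp add: lin_mat_def sym_matrices_def transpose_def vec_eq_iff)

lemma feasible_a_vec_nonneg:
  assumes "x \<in> feasible_set A0 A" "t \<in> std_simplex"
  shows "0 \<le> (1, x) \<bullet> a_vec A0 A t"
  using assms std_simplex_nonneg[of t]
  by (simp add: feasible_set_def copositive_cone_def flip: quadratic_lin_mat)

lemma continuous_a_vec: "continuous_on S (a_vec A0 A)"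
  unfolding a_vec_def
  by (intro continuous_intros continuous_on_vec_lambda matrix_vector_mult_linear_continuous_on)

lemma convex_one_inner_ge: "convex {x :: 'b::euclidean_space. 0 \<le> (1 :: real, x) \<bullet> v}"
proof -
  obtain d c where v: "v = (d, c)" by (cases v)
  have "{x. 0 \<le> (1 :: real, x) \<bullet> v} = {x. - d \<le> c \<bullet> x}"
    by (auto simp: v inner_commute)
  then show ?thesis by (simp add: convex_halfspace_ge)
qed

section \<open>Uniform duality as a statement about cones\<close>

text \<open>
  The map whose last \<open>n\<close> components are prescribed by dual feasibility and whose component \<open>0\<close> is
  the negative of the dual objective.
\<close>

definition coupling ::
    "real ^ 'p ^ 'p \<Rightarrow> ('n::finite \<Rightarrow> real ^ 'p ^ 'p) \<Rightarrow> real ^ 'p ^ 'p \<Rightarrow> real \<times> (real ^ 'n)" where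
  "coupling A0 A U = (mat_inner U A0, \<chi> m. mat_inner U (A m))"

lemma linear_coupling:
  fixes A0 :: "real ^ 'p ^ 'p" and A :: "'n::finite \<Rightarrow> real ^ 'p ^ 'p"
  shows "linear (coupling A0 A)"
proof -
  have "mat_inner (U + V) D = mat_inner U D + mat_inner V D"
    and "mat_inner (r *\<^sub>R U) D = r * mat_inner U D" for U V D :: "real ^ 'p ^ 'p" and r
    by (simp_all add: mat_inner_def trace_def matrix_matrix_mult_def distrib_right sum.distrib
        sum_distrib_left mult.assoc)
  then show ?thesis
    by (intro linearI) (simp_all add: coupling_def vec_eq_iff)
qed

lemma coupling_rank_one:
  fixes A0 :: "real ^ 'p ^ 'p" and A :: "'n::finite \<Rightarrow> real ^ 'p ^ 'p"
  shows "coupling A0 A (\<chi> i j. t $ i * t $ j) = a_vec A0 A t"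
proof -
  have "mat_inner (\<chi> i j. t $ i * t $ j) D = t \<bullet> (D *v t)" for D :: "real ^ 'p ^ 'p"
  proof -
    have "mat_inner (\<chi> i j. t $ i * t $ j) D = (\<Sum>i\<in>UNIV. \<Sum>j\<in>UNIV. t $ i * t $ j * D $ j $ i)"
      by (simp add: mat_inner_def trace_def matrix_matrix_mult_def)
    also have "\<dots> = (\<Sum>j\<in>UNIV. \<Sum>i\<in>UNIV. t $ i * t $ j * D $ j $ i)"
      by (rule sum.swap)
    also have "\<dots> = t \<bullet> (D *v t)"
      by (simp add: inner_vec_def matrix_vector_mult_def sum_distrib_left mult_ac)
    finally show ?thesis .
  qed
  then show ?thesis by (simp add: coupling_def a_vec_def)
qed

lemma a_vec_scaleR: "a_vec A0 A (r *\<^sub>R t) = r\<^sup>2 *\<^sub>R a_vec A0 A t"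
  by (simp add: a_vec_def vec_eq_iff matrix_vector_mult_scaleR power2_eq_square)

lemma a_vec_0: "a_vec A0 A 0 = 0"
  by (simp add: a_vec_def vec_eq_iff zero_prod_def)

text \<open>
  Rank-one matrices go to the \<open>a(t)\<close> with \<open>t \<ge> 0\<close>; as \<open>a\<close> is homogeneous of degree two, the
  scaling of \<open>t\<close> supplies the nonnegative weights of a conic combination over the simplex.
\<close>

lemma coupling_completely_positive:
  "coupling A0 A ` completely_positive_cone = fin_cone (a_vec A0 A ` std_simplex)"
proof -
  let ?a = "a_vec A0 A"
  have "coupling A0 A ` completely_positive_cone = convex hull (?a ` nonneg_vectors)"
    unfolding completely_positive_cone_def
    by (simp add: convex_hull_linear_image[OF linear_coupling] image_image coupling_rank_one)
  also have "\<dots> = convex_cone hull (?a ` std_simplex)"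
  proof
    have "?a t \<in> convex_cone hull (?a ` std_simplex)" if t: "t \<in> nonneg_vectors" for t
    proof (cases "t = 0")
      case True
      then show ?thesis by (simp add: a_vec_0 convex_cone_hull_contains_0)
    next
      case False
      then obtain r w where "w \<in> std_simplex" "t = r *\<^sub>R w"
        using nonneg_vector_normalize t by metis
      then show ?thesis
        by (simp add: a_vec_scaleR convex_cone_hull_mul hull_inc)
    qed
    then show "convex hull (?a ` nonneg_vectors) \<subseteq> convex_cone hull (?a ` std_simplex)"
      by (intro hull_minimal convex_convex_cone_hull) auto
  next
    show "convex_cone hull (?a ` std_simplex) \<subseteq> convex hull (?a ` nonneg_vectors)"
    proof
      fix y assume "y \<in> convex_cone hull (?a ` std_simplex)"
      then consider "y = 0" | v r where "v \<in> convex hull (?a ` std_simplex)" "0 \<le> r" "y = r *\<^sub>R v"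
        unfolding convex_cone_hull_convex_hull by auto
      then show "y \<in> convex hull (?a ` nonneg_vectors)"
      proof cases
        case 1
        have "?a 0 \<in> convex hull (?a ` nonneg_vectors)"
          by (intro hull_inc imageI) (simp add: nonneg_vectors_def)
        with 1 show ?thesis by (simp add: a_vec_0)
      next
        case (2 v r)
        have "r *\<^sub>R ?a t \<in> ?a ` nonneg_vectors" if "t \<in> std_simplex" for t
          using that 2(2)
          by (intro image_eqI[of _ _ "sqrt r *\<^sub>R t"])
            (auto simp: a_vec_scaleR std_simplex_def nonneg_vectors_def)
        then have "convex hull ((\<lambda>x. r *\<^sub>R x) ` ?a ` std_simplex) \<subseteq> convex hull (?a ` nonneg_vectors)"
          by (intro hull_mono) auto
        moreover have "y \<in> convex hull ((\<lambda>x. r *\<^sub>R x) ` ?a ` std_simplex)"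
          unfolding convex_hull_scaling using 2 by blast
        ultimately show ?thesis by blast
      qed
    qed
  qed
  finally show ?thesis by (simp add: fin_cone_eq_convex_cone_hull)
qed

lemma dual_feasible_iff_coupling:
  "U \<in> dual_feasible_set A c \<longleftrightarrow>
    U \<in> completely_positive_cone \<and> coupling A0 A U = (mat_inner U A0, c)"
  by (auto simp: dual_feasible_set_def coupling_def vec_eq_iff)

lemma feasible_nonneg_on_fin_cone:
  assumes x: "x \<in> feasible_set A0 A" and y: "y \<in> fin_cone (a_vec A0 A ` std_simplex)"
  shows "0 \<le> (1, x) \<bullet> y"
proof -
  have "fin_cone (a_vec A0 A ` std_simplex) \<subseteq> {y. 0 \<le> (1, x) \<bullet> y}"
    unfolding fin_cone_eq_convex_cone_hull
    by (rule hull_minimal)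
      (use feasible_a_vec_nonneg[OF x] in
        \<open>auto simp: convex_cone_halfspace_ge simp del: inner_Pair\<close>)
  with y show ?thesis by blast
qed

lemma weak_duality:
  assumes x: "x \<in> feasible_set A0 A" and U: "U \<in> dual_feasible_set A c"
  shows "- mat_inner U A0 \<le> c \<bullet> x"
proof -
  have "(mat_inner U A0, c) \<in> fin_cone (a_vec A0 A ` std_simplex)"
    using U unfolding dual_feasible_iff_coupling[of U A c A0]
    by (metis coupling_completely_positive imageI)
  from feasible_nonneg_on_fin_cone[OF x this] show ?thesis
    by (simp add: inner_commute)
qed

text \<open>
  Vanishing at a feasible point makes \<open>- d\<close> the attained primal value for \<open>q = (d, c)\<close>; an optimal
  dual matrix then represents \<open>q\<close> exactly, with no slack along \<open>(1, 0)\<close>.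
\<close>

lemma uniform_LP_duality_active:
  assumes dual: "uniform_LP_duality A0 A"
    and q: "\<And>x. x \<in> feasible_set A0 A \<Longrightarrow> 0 \<le> (1, x) \<bullet> q"
    and x0: "x0 \<in> feasible_set A0 A" "(1, x0) \<bullet> q = 0"
  shows "q \<in> fin_cone (a_vec A0 A ` std_simplex)"
proof -
  obtain d c where dc: "q = (d, c)" by (cases q)
  have "primal_val A0 A c = ereal (- d)"
    unfolding primal_val_def
  proof (rule antisym)
    show "(INF x\<in>feasible_set A0 A. ereal (c \<bullet> x)) \<le> ereal (- d)"
      using x0 by (intro INF_lower2[of x0]) (auto simp: dc inner_commute)
    show "ereal (- d) \<le> (INF x\<in>feasible_set A0 A. ereal (c \<bullet> x))"
    proof (rule INF_greatest)
      fix x assume "x \<in> feasible_set A0 A"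
      from q[OF this] show "ereal (- d) \<le> ereal (c \<bullet> x)" by (simp add: dc inner_commute)
    qed
  qed
  with dual obtain U where U: "dual_optimal A0 A c U" and val: "dual_val A0 A c = ereal (- d)"
    unfolding uniform_LP_duality_def by force
  have "dual_val A0 A c = ereal (- mat_inner U A0)"
    unfolding dual_val_def using U
    by (intro antisym SUP_least SUP_upper) (auto simp: dual_optimal_def)
  with val have "mat_inner U A0 = d" by simp
  moreover have "U \<in> dual_feasible_set A c" using U by (simp add: dual_optimal_def)
  ultimately show ?thesis
    unfolding dc dual_feasible_iff_coupling[of U A c A0]
    by (metis coupling_completely_positive imageI)
qed

text \<open>
  With \<open>v\<close> the primal value, \<open>(- v, c)\<close> is in the polar and so has the form \<open>(s, 0) + y\<close> with \<open>y\<close> in the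
  cone of the \<open>a(t)\<close>. Here \<open>s = 0\<close>, since \<open>y\<close> witnesses that \<open>v + s\<close> is also a lower bound.
  A completely positive preimage of \<open>y\<close> is the dual optimum.
\<close>

lemma uniform_LP_duality_if_polar_le_cone:
  assumes cons: "consistent_system A0 A"
    and polar: "\<And>q. (\<And>x. x \<in> feasible_set A0 A \<Longrightarrow> 0 \<le> (1, x) \<bullet> q) \<Longrightarrow>
      q \<in> convex_cone hull (insert (1, 0) (a_vec A0 A ` std_simplex))"
  shows "uniform_LP_duality A0 A"
  unfolding uniform_LP_duality_def
proof (intro allI impI)
  fix c assume fin: "primal_val A0 A c > - \<infinity>"
  let ?X = "feasible_set A0 A"
  obtain x0 where x0: "x0 \<in> ?X" using cons by (auto simp: consistent_system_def)
  then have "primal_val A0 A c \<le> ereal (c \<bullet> x0)"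
    unfolding primal_val_def by (rule INF_lower)
  with fin obtain v where v: "primal_val A0 A c = ereal v"
    by (cases "primal_val A0 A c") auto
  have v_le: "v \<le> c \<bullet> x" if "x \<in> ?X" for x
  proof -
    have "primal_val A0 A c \<le> ereal (c \<bullet> x)"
      unfolding primal_val_def using that by (rule INF_lower)
    with v show ?thesis by simp
  qed
  have "0 \<le> (1, x) \<bullet> (- v, c)" if "x \<in> ?X" for x
    using v_le[OF that] by (simp add: inner_commute)
  then have "(- v, c) \<in> convex_cone hull ({(1, 0)} \<union> a_vec A0 A ` std_simplex)"
    using polar by simp
  then obtain e y where e: "e \<in> convex_cone hull {(1, 0)}"
    and y: "y \<in> fin_cone (a_vec A0 A ` std_simplex)" and sum: "(- v, c) = e + y"
    unfolding convex_cone_hull_Un fin_cone_eq_convex_cone_hull by blast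
  from e obtain s where s: "0 \<le> s" "e = (s, 0)"
    by (auto simp: convex_cone_hull_convex_hull_nonempty)
  have y_eq: "y = (- v - s, c)" using sum s by (cases y) auto
  have "ereal (v + s) \<le> primal_val A0 A c"
    unfolding primal_val_def
  proof (rule INF_greatest)
    fix x assume "x \<in> ?X"
    from feasible_nonneg_on_fin_cone[OF this y] show "ereal (v + s) \<le> ereal (c \<bullet> x)"
      by (simp add: y_eq inner_commute)
  qed
  with v s have "s = 0" by simp
  with y_eq y obtain U where U: "U \<in> completely_positive_cone" "coupling A0 A U = (- v, c)"
    using coupling_completely_positive[of A0 A] by (metis diff_zero imageE)
  then have Uv: "U \<in> dual_feasible_set A c" "mat_inner U A0 = - v"
    by (auto simp: dual_feasible_set_def coupling_def)
  have "- mat_inner V A0 \<le> v" if "V \<in> dual_feasible_set A c" for V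
  proof -
    have "ereal (- mat_inner V A0) \<le> primal_val A0 A c"
      unfolding primal_val_def by (rule INF_greatest) (simp add: weak_duality[OF _ that])
    with v show ?thesis by simp
  qed
  then have V: "- mat_inner V A0 \<le> - mat_inner U A0" if "V \<in> dual_feasible_set A c" for V
    using that Uv by simp
  then have opt: "dual_optimal A0 A c U" using Uv by (simp add: dual_optimal_def)
  have "dual_val A0 A c = ereal (- mat_inner U A0)"
    unfolding dual_val_def using Uv(1) V by (intro antisym SUP_least SUP_upper) auto
  with opt v Uv(2) show "(\<exists>U. dual_optimal A0 A c U) \<and> primal_val A0 A c = dual_val A0 A c"
    by auto
qed

section \<open>Immobile indices\<close>

text \<open>
  Complementary slackness: a sum of nonnegative terms that is zero at \<open>x\<close> has only zero terms.
\<close>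

lemma fin_cone_face:
  assumes Y: "Y \<subseteq> feasible_set A0 A"
    and q: "q \<in> fin_cone (a_vec A0 A ` std_simplex)" and zero: "\<And>x. x \<in> Y \<Longrightarrow> (1, x) \<bullet> q = 0"
  shows "q \<in> fin_cone (a_vec A0 A ` null_indices A0 A Y)"
proof -
  obtain F u where F: "finite F" "F \<subseteq> a_vec A0 A ` std_simplex" "\<forall>v\<in>F. 0 \<le> u v"
    and q_eq: "q = (\<Sum>v\<in>F. u v *\<^sub>R v)"
    using q unfolding fin_cone_def by blast
  define G where "G = {v \<in> F. u v \<noteq> 0}"
  have "v \<in> a_vec A0 A ` null_indices A0 A Y" if v: "v \<in> G" for v
  proof -
    obtain t where t: "t \<in> std_simplex" "v = a_vec A0 A t"
      using v F by (auto simp: G_def)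
    have "(1, x) \<bullet> v = 0" if x: "x \<in> Y" for x
    proof -
      have nonneg: "0 \<le> u w * ((1, x) \<bullet> w)" if w: "w \<in> F" for w
      proof -
        obtain s where s: "s \<in> std_simplex" "w = a_vec A0 A s"
          using w F(2) by auto
        then have "0 \<le> (1, x) \<bullet> w"
          using x Y feasible_a_vec_nonneg by blast
        with F(3) w show ?thesis by simp
      qed
      have "(\<Sum>w\<in>F. u w * ((1, x) \<bullet> w)) = 0"
        using zero[OF x] by (simp add: q_eq inner_sum_right)
      then have "u v * ((1, x) \<bullet> v) = 0"
        using nonneg v F(1) by (subst (asm) sum_nonneg_eq_0_iff) (auto simp: G_def)
      with v show ?thesis by (simp add: G_def)
    qed
    with t show ?thesis by (auto simp: null_indices_def quadratic_lin_mat simp del: inner_Pair)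
  qed
  moreover have "q = (\<Sum>v\<in>G. u v *\<^sub>R v)"
    unfolding q_eq G_def using F(1) by (intro sum.mono_neutral_right) auto
  ultimately show ?thesis
    using F(1,3) unfolding fin_cone_def by (intro CollectI exI[of _ G] exI[of _ u]) (auto simp: G_def)
qed

lemma compact_immobile_indices: "compact (immobile_indices A0 A)"
proof -
  have eq: "immobile_indices A0 A =
      std_simplex \<inter> (\<Inter>x\<in>feasible_set A0 A. {t. t \<bullet> (lin_mat A0 A x *v t) = 0})"
    by (auto simp: immobile_indices_def null_indices_def)
  show ?thesis
    unfolding eq
    by (intro compact_Int_closed compact_std_simplex closed_INT ballI closed_Collect_eq
        continuous_intros matrix_vector_mult_linear_continuous_on)
qed

lemma immobile_vertices_immobile: "immobile_vertices A0 A \<subseteq> immobile_indices A0 A"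
  unfolding immobile_vertices_def by (rule extreme_points_of_convex_hull)

text \<open>
  Otherwise every vertex has positive mass outside the support of \<open>t\<close>, hence so does every point of
  their convex hull. By the Krein-Milman theorem \<open>t\<close> is such a point, a contradiction.
\<close>

lemma immobile_support_contains_vertex_support:
  fixes A0 :: "real ^ 'p ^ 'p" and A :: "'n::finite \<Rightarrow> real ^ 'p ^ 'p"
  assumes t: "t \<in> immobile_indices A0 A"
  obtains \<tau> where "\<tau> \<in> immobile_vertices A0 A" "support \<tau> \<subseteq> support t"
proof (rule ccontr)
  let ?V = "immobile_vertices A0 A"
  assume "\<not> thesis"
  with that have none: "\<not> support \<tau> \<subseteq> support t" if "\<tau> \<in> ?V" for \<tau>
    using that by blast
  define S where "S = - support t"
  define f :: "real ^ 'p \<Rightarrow> real" where "f s = (\<Sum>k\<in>S. s $ k)" for s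
  have "linear f"
    by (intro linearI) (simp_all add: f_def sum.distrib sum_distrib_left)
  have "?V \<subseteq> {s. 0 < f s}"
  proof
    fix \<tau> assume \<tau>: "\<tau> \<in> ?V"
    then have "\<tau> \<in> std_simplex"
      using immobile_vertices_immobile by (auto simp: immobile_indices_def null_indices_def)
    then have nn: "0 \<le> \<tau> $ k" for k
      by (simp add: std_simplex_def nonneg_vectors_def)
    obtain k where k: "k \<in> support \<tau>" "k \<notin> support t" using none[OF \<tau>] by blast
    with nn[of k] have "0 < \<tau> $ k" by (simp add: support_def)
    with k nn have "0 < f \<tau>"
      unfolding f_def S_def by (intro sum_pos2[of _ k]) auto
    then show "\<tau> \<in> {s. 0 < f s}" by simp
  qed
  moreover have "convex {s. 0 < f s}"
    using convex_linear_vimage[OF \<open>linear f\<close>, of "{0<..}"] by (simp add: vimage_def)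
  ultimately have "convex hull ?V \<subseteq> {s. 0 < f s}"
    by (rule hull_minimal)
  moreover have "t \<in> convex hull ?V"
    using Krein_Milman_Minkowski[OF compact_convex_hull[OF compact_immobile_indices], of A0 A] t
    unfolding immobile_vertices_def by (auto simp: hull_inc)
  ultimately have "0 < f t" by blast
  moreover have "f t = 0"
    unfolding f_def S_def by (intro sum.neutral) (simp add: support_def)
  ultimately show False by simp
qed

text \<open>
  Only the supports of the vertices matter for avoidance, so one vertex per support is enough to
  work with a finite family of linear constraints.
\<close>

lemma finite_support_representatives:
  fixes V :: "(real ^ 'p) set"
  obtains V0 where "finite V0" "V0 \<subseteq> V" "support ` V0 = support ` V"
  using finite_subset_image[of "support ` V" support V] by (metis finite subset_refl)

lemma gradient_nonneg_at_vertex: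
  assumes "\<tau> \<in> immobile_vertices A0 A" "x \<in> feasible_set A0 A"
  shows "0 \<le> (1, x) \<bullet> b_vec A0 A k \<tau>"
proof -
  have "\<tau> \<in> immobile_indices A0 A" using assms immobile_vertices_immobile by blast
  then show ?thesis
    using assms(2) copositive_gradient_nonneg[of "lin_mat A0 A x" \<tau> k]
    by (simp add: immobile_indices_def null_indices_def feasible_set_def std_simplex_def
        gradient_lin_mat del: inner_Pair)
qed

section \<open>The characterization\<close>

text \<open>
  \<open>X\<close> is rewritten as the system \<open>S\<close> of the constraints \<open>b(k, \<tau>)\<close> in \<open>Act\<close>, which are active somewhere on
  \<open>X\<close>, and the constraints \<open>a(w)\<close> with \<open>w \<in> \<Omega>\<close>. This system satisfies the hypotheses of
  \<open>semi_infinite_Farkas\<close>.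
\<close>

lemma uniform_LP_duality_if_gradients_in_cone:
  fixes A0 :: "real ^ 'p ^ 'p" and A :: "'n::finite \<Rightarrow> real ^ 'p ^ 'p"
  assumes sym: "A0 \<in> sym_matrices" "\<And>m. A m \<in> sym_matrices"
    and cons: "consistent_system A0 A"
    and b: "\<And>\<tau> k. \<tau> \<in> immobile_vertices A0 A \<Longrightarrow> k \<in> N_star_set A0 A \<tau> \<Longrightarrow>
      b_vec A0 A k \<tau> \<in> fin_cone (a_vec A0 A ` std_simplex)"
  shows "uniform_LP_duality A0 A"
proof (rule uniform_LP_duality_if_polar_le_cone[OF cons])
  let ?X = "feasible_set A0 A" and ?a = "a_vec A0 A" and ?b = "\<lambda>(k, \<tau>). b_vec A0 A k \<tau>"
  fix q :: "real \<times> (real ^ 'n)"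
  assume q: "\<And>x. x \<in> ?X \<Longrightarrow> 0 \<le> (1, x) \<bullet> q"
  obtain V where V: "finite V" "V \<subseteq> immobile_vertices A0 A"
    "support ` V = support ` immobile_vertices A0 A"
    by (rule finite_support_representatives)
  have V_simplex: "V \<subseteq> std_simplex"
    using V(2) immobile_vertices_immobile[of A0 A]
    by (auto simp: immobile_indices_def null_indices_def)
  define \<Omega> where "\<Omega> = avoiding_indices V"
  define Act where "Act = {(k, \<tau>). \<tau> \<in> V \<and> k \<in> N_star_set A0 A \<tau>}"
  define Ina where "Ina = {(k, \<tau>). \<tau> \<in> V \<and> k \<notin> N_star_set A0 A \<tau>}"
  have fin: "finite Act" "finite Ina"
    by (rule finite_subset[of _ "UNIV \<times> V"]; use V(1) in \<open>auto simp: Act_def Ina_def\<close>)+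
  define S where "S = {x. \<forall>v \<in> ?b ` Act \<union> ?a ` \<Omega>. 0 \<le> (1, x) \<bullet> v}"
  have X_S: "{x \<in> S. \<forall>i\<in>Ina. 0 \<le> (1, x) \<bullet> ?b i} = ?X"
  proof (intro set_eqI iffI)
    fix x assume x: "x \<in> {x \<in> S. \<forall>i\<in>Ina. 0 \<le> (1, x) \<bullet> ?b i}"
    have "lin_mat A0 A x \<in> copositive_cone"
    proof (rule copositive_by_support_reduction[OF _ V_simplex])
      show "lin_mat A0 A x \<in> sym_matrices" using sym by (rule lin_mat_symmetric)
      show "0 \<le> axis k 1 \<bullet> (lin_mat A0 A x *v \<tau>)" if "\<tau> \<in> V" for \<tau> k
      proof (cases "k \<in> N_star_set A0 A \<tau>")
        case True
        then have "b_vec A0 A k \<tau> \<in> ?b ` Act"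
          using that by (force simp: Act_def)
        with x show ?thesis unfolding gradient_lin_mat S_def by blast
      next
        case False
        then have "(k, \<tau>) \<in> Ina" using that by (simp add: Ina_def)
        with x have "0 \<le> (1, x) \<bullet> ?b (k, \<tau>)" by blast
        then show ?thesis by (simp only: gradient_lin_mat prod.case)
      qed
      show "0 \<le> w \<bullet> (lin_mat A0 A x *v w)" if "w \<in> avoiding_indices V" for w
        using x that unfolding quadratic_lin_mat S_def \<Omega>_def by blast
    qed
    then show "x \<in> ?X" by (simp add: feasible_set_def)
  next
    fix x assume x: "x \<in> ?X"
    have "0 \<le> (1, x) \<bullet> ?b i" if "i \<in> Act \<union> Ina" for i
      using that V(2) gradient_nonneg_at_vertex[OF _ x]
      by (auto simp: Act_def Ina_def simp del: inner_Pair)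
    moreover have "0 \<le> (1, x) \<bullet> ?a w" if "w \<in> \<Omega>" for w
      using that feasible_a_vec_nonneg[OF x] by (simp add: \<Omega>_def avoiding_indices_def)
    ultimately show "x \<in> {x \<in> S. \<forall>i\<in>Ina. 0 \<le> (1, x) \<bullet> ?b i}"
      unfolding S_def by blast
  qed
  have ne: "?X \<noteq> {}" using cons by (simp add: consistent_system_def)
  have "S = (\<Inter>v \<in> ?b ` Act \<union> ?a ` \<Omega>. {x. 0 \<le> (1, x) \<bullet> v})"
    unfolding S_def by auto
  then have "convex S"
    by (simp only: convex_INT convex_one_inner_ge)
  (* a constraint outside the N-star sets is never active on X, hence redundant *)
  have "{x \<in> S. \<forall>i\<in>Ina. 0 \<le> (1, x) \<bullet> ?b i} = S"
  proof (rule inactive_constraints_redundant[OF \<open>convex S\<close> fin(2)])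
    show "continuous_on UNIV (\<lambda>x. (1, x) \<bullet> ?b i)" for i
      by (intro continuous_intros)
    show "{x \<in> S. \<forall>i\<in>Ina. 0 \<le> (1, x) \<bullet> ?b i} \<noteq> {}" using X_S ne by simp
    fix x i assume "x \<in> S" "\<forall>i\<in>Ina. 0 \<le> (1, x) \<bullet> ?b i" "i \<in> Ina"
    then have "x \<in> ?X" "i \<in> Ina" using X_S by blast+
    then show "(1, x) \<bullet> ?b i \<noteq> 0"
      by (cases i) (auto simp: Ina_def N_star_set_def gradient_lin_mat simp del: inner_Pair)
  qed
  with X_S have X_eq: "?X = S" by simp
  (* an index on which the form vanishes for every feasible x is immobile and cannot lie in \<Omega> *)
  have strict: "\<exists>x\<in>?X. 0 < (1, x) \<bullet> ?a w" if w: "w \<in> \<Omega>" for w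
  proof (rule ccontr)
    assume no: "\<not> (\<exists>x\<in>?X. 0 < (1, x) \<bullet> ?a w)"
    have "(1, x) \<bullet> ?a w = 0" if x: "x \<in> ?X" for x
    proof -
      have "0 \<le> (1, x) \<bullet> ?a w"
        using x w unfolding X_eq S_def by blast
      with no x show ?thesis by force
    qed
    then have "w \<in> immobile_indices A0 A"
      using w unfolding immobile_indices_def null_indices_def \<Omega>_def avoiding_indices_def
      by (simp add: quadratic_lin_mat del: inner_Pair)
    then obtain \<tau> where \<tau>: "\<tau> \<in> immobile_vertices A0 A" "support \<tau> \<subseteq> support w"
      by (rule immobile_support_contains_vertex_support)
    from \<tau>(1) V(3) obtain \<tau>' where "\<tau>' \<in> V" "support \<tau>' = support \<tau>"
      by (metis imageE imageI)
    with \<tau>(2) have "\<exists>\<tau>\<in>V. support \<tau> \<subseteq> support w" by auto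
    with w show False unfolding \<Omega>_def avoiding_indices_def by blast
  qed
  have "compact \<Omega>" unfolding \<Omega>_def by (rule compact_avoiding_indices)
  then have compact: "compact (?a ` \<Omega>)"
    by (intro compact_continuous_image continuous_a_vec)
  have "\<exists>h \<in> Pair 1 ` ?X. \<forall>v \<in> ?a ` \<Omega>. 0 < h \<bullet> v"
  proof (rule exists_common_strict_point[OF _ _ compact])
    have "convex ({1 :: real} \<times> ?X)"
      using \<open>convex S\<close> X_eq by (simp add: convex_Times)
    moreover have "{1 :: real} \<times> ?X = Pair (1::real) ` ?X" by auto
    ultimately show "convex (Pair (1::real) ` ?X)" by simp
    show "Pair (1::real) ` ?X \<noteq> {}" using ne by simp
    show "0 \<le> h \<bullet> v" if "h \<in> Pair 1 ` ?X" "v \<in> ?a ` \<Omega>" for h v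
      using that unfolding X_eq S_def by blast
    show "\<exists>h \<in> Pair 1 ` ?X. 0 < h \<bullet> v" if "v \<in> ?a ` \<Omega>" for v
      using that strict by blast
  qed
  then obtain xbar where xbar: "xbar \<in> ?X" "\<And>v. v \<in> ?a ` \<Omega> \<Longrightarrow> 0 < (1, xbar) \<bullet> v"
    by blast
  have "q \<in> convex_cone hull (insert (1, 0) (?b ` Act \<union> ?a ` \<Omega>))"
  proof (rule semi_infinite_Farkas[OF _ compact _ xbar(2)])
    show "finite (?b ` Act)" using fin(1) by simp
    show "0 \<le> (1, xbar) \<bullet> v" if "v \<in> ?b ` Act" for v
      using xbar(1) that unfolding X_eq S_def by blast
    show "0 \<le> (1, x) \<bullet> q" if "\<And>v. v \<in> ?b ` Act \<union> ?a ` \<Omega> \<Longrightarrow> 0 \<le> (1, x) \<bullet> v" for x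
      using that by (intro q) (simp add: X_eq S_def del: inner_Pair)
  qed
  moreover have "insert (1, 0) (?b ` Act \<union> ?a ` \<Omega>) \<subseteq>
      convex_cone hull (insert (1, 0) (?a ` std_simplex))" (is "_ \<subseteq> ?C")
  proof -
    have "?b i \<in> ?C" if "i \<in> Act" for i
    proof -
      have "?b i \<in> convex_cone hull (?a ` std_simplex)"
        using that b V(2) by (auto simp: Act_def simp flip: fin_cone_eq_convex_cone_hull)
      then show ?thesis using hull_mono[of "?a ` std_simplex"] by blast
    qed
    moreover have "?a w \<in> ?C" if "w \<in> \<Omega>" for w
      using that by (intro hull_inc) (simp add: \<Omega>_def avoiding_indices_def)
    ultimately show ?thesis by (auto intro: hull_inc)
  qed
  ultimately show "q \<in> convex_cone hull (insert (1, 0) (?a ` std_simplex))"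
    using hull_minimal convex_cone_convex_cone_hull by blast
qed

theorem theorem1:
  fixes A0 :: "real ^ 'p ^ 'p" and A :: "'n::finite \<Rightarrow> real ^ 'p ^ 'p"
  assumes "CARD('p) > 1"
    and "A0 \<in> sym_matrices" and "\<And>m. A m \<in> sym_matrices"
    and "consistent_system A0 A"
  shows "uniform_LP_duality A0 A \<longleftrightarrow>
     (\<forall>\<tau>\<in>immobile_vertices A0 A. \<forall>k\<in>M_set A0 A \<tau>.
        b_vec A0 A k \<tau> \<in> fin_cone (a_vec A0 A ` immobile_indices A0 A)) \<and>
     (\<forall>\<tau>\<in>immobile_vertices A0 A. \<forall>k\<in>N_set A0 A \<tau>.
        b_vec A0 A k \<tau> \<in> fin_cone (a_vec A0 A ` immobile_indices_face A0 A k \<tau>))"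
    (is "_ \<longleftrightarrow> ?I \<and> ?II")
proof
  assume dual: "uniform_LP_duality A0 A"
  have ne: "feasible_set A0 A \<noteq> {}" using assms(4) by (simp add: consistent_system_def)
  (* Y is the whole feasible set for the first condition, a face for the second *)
  have b: "b_vec A0 A k \<tau> \<in> fin_cone (a_vec A0 A ` null_indices A0 A Y)"
    if \<tau>: "\<tau> \<in> immobile_vertices A0 A" and Y: "Y \<subseteq> feasible_set A0 A" "Y \<noteq> {}"
      and zero: "\<And>x. x \<in> Y \<Longrightarrow> (1, x) \<bullet> b_vec A0 A k \<tau> = 0" for k \<tau> Y
  proof (rule fin_cone_face[OF Y(1) _ zero])
    from Y obtain x0 where x0: "x0 \<in> Y" "x0 \<in> feasible_set A0 A" by blast
    show "b_vec A0 A k \<tau> \<in> fin_cone (a_vec A0 A ` std_simplex)"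
      by (rule uniform_LP_duality_active[OF dual gradient_nonneg_at_vertex[OF \<tau>] x0(2) zero[OF x0(1)]])
  qed
  have ?I
    unfolding immobile_indices_def using ne
    by (intro ballI b) (auto simp: M_set_def gradient_lin_mat simp del: inner_Pair)
  moreover have ?II
    unfolding immobile_indices_face_def
    by (intro ballI b)
      (auto simp: N_set_def N_star_set_def feasible_face_def gradient_lin_mat simp del: inner_Pair)
  ultimately show "?I \<and> ?II" ..
next
  assume conds: "?I \<and> ?II"
  show "uniform_LP_duality A0 A"
  proof (rule uniform_LP_duality_if_gradients_in_cone[OF assms(2-4)])
    fix \<tau> k assume \<tau>: "\<tau> \<in> immobile_vertices A0 A" and k: "k \<in> N_star_set A0 A \<tau>"
    have "fin_cone (a_vec A0 A ` null_indices A0 A Y) \<subseteq> fin_cone (a_vec A0 A ` std_simplex)" for Y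
      unfolding fin_cone_eq_convex_cone_hull
      by (intro hull_mono image_mono) (auto simp: null_indices_def)
    (* an index in the N-star set lies in the M set or in the N set *)
    with conds \<tau> k show "b_vec A0 A k \<tau> \<in> fin_cone (a_vec A0 A ` std_simplex)"
      unfolding immobile_indices_def immobile_indices_face_def N_set_def by blast
  qed
qed

end
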